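(* Any $n$-vertex graph $G$ with contiguity $\ell$ has a biclique decomposition with at most $2n$ bicliques such that every vertex belongs to at most $(\ell+1)\lceil\log_2 n\rceil$ bicliques.
   Context: Graphs are finite, simple and undirected. $N(v)$ denotes the set of neighbors of a vertex $v$ (so $v\notin N(v)$). Given a total ordering $\preceq$ on $V(G)$ and a vertex $v$, let $\ell_{\preceq}(v)$ be the number of inclusion-wise maximal intervals in $\preceq$ such that $N(v)$ is the union of those intervals (i.e. the number of maximal sets of consecutive vertices contained in $N(v)$). The contiguity of $G$ is $\ell(G)=\min_{\preceq}\max_{v}\ell_{\preceq}(v)$, where $\preceq$ ranges over total orderings of $V(G)$ and $v$ over $V(G)$. A biclique of $G$ is a complete bipartite subgraph of $G$ (not necessarily induced). A biclique decomposition of $G$ is a collection of bicliques of $G$ such that every edge of $G$ is contained in exactly one of them. *)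

theory Defs
  imports Complex_Main "Graph_Theory.Graph_Theory"
begin

text \<open>
  A finite simple undirected graph is a \<^locale>\<open>pair_graph\<close>: a finite loop-free digraph
  with a symmetric arc set, the edge \<open>uv\<close> being the two arcs \<open>(u, v)\<close> and \<open>(v, u)\<close>.
\<close>

definition nbhd :: "'a pair_pre_digraph \<Rightarrow> 'a \<Rightarrow> 'a set" where
  "nbhd G v = {u. (v, u) \<in> parcs G}"

definition order_interval :: "'a set \<Rightarrow> 'a rel \<Rightarrow> 'a set \<Rightarrow> bool" where
  "order_interval V r I \<longleftrightarrow> I \<subseteq> V \<and>
     (\<forall>x\<in>I. \<forall>y\<in>I. \<forall>z\<in>V. (x, z) \<in> r \<and> (z, y) \<in> r \<longrightarrow> z \<in> I)"

text \<open>
  Intervals are required to be nonempty, so that an empty set has no maximal interval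
  (rather than the single interval \<open>{}\<close>).
\<close>

definition maximal_intervals :: "'a set \<Rightarrow> 'a rel \<Rightarrow> 'a set \<Rightarrow> 'a set set" where
  "maximal_intervals V r S =
     {I. I \<noteq> {} \<and> order_interval V r I \<and> I \<subseteq> S \<and>
         (\<forall>J. order_interval V r J \<and> J \<subseteq> S \<and> I \<subseteq> J \<longrightarrow> J = I)}"

definition vertex_contiguity :: "'a pair_pre_digraph \<Rightarrow> 'a rel \<Rightarrow> 'a \<Rightarrow> nat" where
  "vertex_contiguity G r v = card (maximal_intervals (pverts G) r (nbhd G v))"

text \<open>
  For a finite graph, infimum and supremum are a minimum and a maximum; on natural numbers
  the supremum of the empty set is \<open>0\<close>, which gives the graph without vertices contiguity \<open>0\<close>.
\<close>

definition contiguity :: "'a pair_pre_digraph \<Rightarrow> nat" where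
  "contiguity G =
     (INF r\<in>{r. linear_order_on (pverts G) r}. SUP v\<in>pverts G. vertex_contiguity G r v)"

text \<open>Both sides of a biclique are nonempty.\<close>

definition biclique :: "'a pair_pre_digraph \<Rightarrow> 'a pair_pre_digraph \<Rightarrow> bool" where
  "biclique G B \<longleftrightarrow> subgraph (with_proj B) (with_proj G) \<and>
     (\<exists>p q. p \<ge> 1 \<and> q \<ge> 1 \<and> complete_bipartite_digraph p q (with_proj B))"

definition biclique_decomposition ::
    "'a pair_pre_digraph \<Rightarrow> 'a pair_pre_digraph set \<Rightarrow> bool" where
  "biclique_decomposition G D \<longleftrightarrow>
     (\<forall>B\<in>D. biclique G B) \<and> (\<forall>e\<in>parcs G. \<exists>!B. B \<in> D \<and> e \<in> parcs B)"

end

theory Submission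
  imports Defs
begin

text \<open>
  Fix a vertex order that attains the contiguity and a binary tree whose leaves, read from left to
  right, are the vertices in that order. Every tree node stands for the interval of the leaves
  below it. Let \<^term>\<open>later G r v\<close> consist of the neighbours of \<open>v\<close> that come after \<open>v\<close>; it is
  partitioned by its \<open>pieces\<close>, the maximal tree nodes contained in it. Each node \<open>X\<close> yields the
  biclique between \<open>X\<close> and its \<open>clients\<close>, the vertices that have \<open>X\<close> as a piece. Every edge is
  seen exactly once, from its earlier endpoint, and there are fewer than \<open>2n\<close> nodes. A vertex
  belongs to one biclique for each of its own pieces, and to one for each proper tree node above
  it that has a client; the latter exist only if the vertex has an earlier neighbour.

  It remains to choose the tree so that both numbers are small. Let \<open>k = \<lceil>log\<^sub>2 n\<rceil>\<close>. In a balanced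
  tree an interval may have about \<open>2k\<close> pieces, twice as many as allowed. But each piece near the left
  end of an interval hangs off a left turn of the path to the vertex just before it, and each piece
  near the right end hangs off a right turn of the path to the vertex just after it. So bound these turns separately: a tree in which every leaf is
  reached with at most \<open>p\<close> left and \<open>q\<close> right turns can have \<open>(p + q) choose p\<close> leaves, and an
  interval then has at most \<open>p + q - 2\<close> pieces, or \<open>p\<close> pieces if it reaches the last vertex. For
  \<open>p \<approx> q\<close> the first number is \<open>k + O(log k)\<close>, and the second is about half of it.

  The excess of order \<open>log k\<close> disappears because different intervals are split apart at different
  tree nodes, and an interval that is split apart at depth \<open>i\<close> saves \<open>i\<close> pieces. There are at
  most \<open>2\<^sup>i\<close> nodes of depth \<open>i\<close>, so if \<open>p + q = k + 2 + d\<close>, then \<open>a\<close> intervals have at most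
  \<open>a k + (\<Sum>i<d. 2\<^sup>i (d - i)) = a k + 2\<^bsup>d+1\<^esup> - d - 2\<close> pieces (\<open>card_pieces\<close>). Choosing \<open>d\<close> with
  \<open>2\<^bsup>d+1\<^esup> \<le> k + 1 < 2\<^bsup>d+2\<^esup>\<close> makes the tree large enough (\<open>power_le_middle_binomial\<close>) and the number
  of pieces at most \<open>a k + k - 1 - d\<close>. A vertex with \<open>a\<close> intervals of later and \<open>b\<close> intervals of
  earlier neighbours has \<open>a + b \<le> \<ell>\<close>, as the vertex itself separates the two kinds. If \<open>b = 0\<close>, its
  pieces are all it pays for; if \<open>b \<ge> 1\<close>, the at most \<open>p + q - 1 = k + 1 + d\<close> nodes above it bring
  the total to \<open>a k + 2 k \<le> (a + b + 1) k\<close>.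
\<close>

section \<open>The middle binomial coefficient\<close>

lemma central_binomial_square_lower:
  "1 \<le> m \<Longrightarrow> 16 ^ m \<le> 4 * m * ((2 * m) choose m)\<^sup>2"
proof (induction m rule: nat_induct_at_least)
  case base
  show ?case by (simp add: power2_eq_square numeral_2_eq_2)
next
  case (Suc m)
  let ?c = "(2 * m) choose m" and ?d = "(2 * Suc m) choose Suc m"
  have rec: "Suc m * ?d = 2 * (2 * m + 1) * ?c"
  proof -
    have 1: "Suc m * ?d = (2 * m + 2) * ((2 * m + 1) choose m)"
      using Suc_times_binomial_eq[of "2 * m + 1" m] by (simp add: mult.commute)
    have "(2 * m + 1) choose m = (2 * m + 1) choose Suc m"
      using binomial_symmetric[of m "2 * m + 1"] by simp
    moreover have "Suc m * ((2 * m + 1) choose Suc m) = (2 * m + 1) * ?c"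
      using Suc_times_binomial_eq[of "2 * m" m] by (simp add: mult.commute)
    ultimately have "(m + 1) * ((2 * m + 1) choose m) = (2 * m + 1) * ?c" by simp
    then have "2 * ((m + 1) * ((2 * m + 1) choose m)) = 2 * ((2 * m + 1) * ?c)" by simp
    with 1 show ?thesis by (simp only: algebra_simps)
  qed
  have "Suc m * 16 ^ Suc m = Suc m * 16 * 16 ^ m" by (simp only: power_Suc mult_ac)
  also have "\<dots> \<le> Suc m * 16 * (4 * m * ?c\<^sup>2)"
    by (rule mult_left_mono[OF Suc.IH]) simp
  also have "\<dots> = 16 * ?c\<^sup>2 * (4 * m * Suc m)" by (simp only: algebra_simps)
  also have "\<dots> \<le> 16 * ?c\<^sup>2 * (2 * m + 1)\<^sup>2"
    by (rule mult_left_mono) (auto simp: power2_eq_square algebra_simps)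
  also have "\<dots> = 4 * (2 * (2 * m + 1) * ?c)\<^sup>2"
    by (simp add: power2_eq_square algebra_simps)
  also have "\<dots> = 4 * (Suc m * ?d)\<^sup>2" by (simp only: rec)
  also have "\<dots> = Suc m * (4 * Suc m * ?d\<^sup>2)" by (simp only: power2_eq_square mult_ac)
  finally show ?case by (simp only: mult_le_cancel1 zero_less_Suc simp_thms)
qed

lemma middle_binomial_square_lower:
  "4 ^ s \<le> 2 * (s + 1) * (s choose (s div 2))\<^sup>2"
proof (cases "even s")
  case True
  then obtain m where s: "s = 2 * m" by blast
  show ?thesis
  proof (cases "m = 0")
    case False
    then have "16 ^ m \<le> 4 * m * ((2 * m) choose m)\<^sup>2"
      by (intro central_binomial_square_lower) simp
    also have "\<dots> \<le> 2 * (2 * m + 1) * ((2 * m) choose m)\<^sup>2" by (intro mult_right_mono) auto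
    finally show ?thesis by (simp add: s power_mult)
  qed (simp add: s)
next
  case False
  then obtain m where s: "s = 2 * m + 1" by (elim oddE)
  have "(2 * m + 1) choose Suc m = (2 * m + 1) choose m"
    using binomial_symmetric[of m "2 * m + 1"] by simp
  then have "(2 * Suc m) choose Suc m = 2 * ((2 * m + 1) choose m)" by simp
  then have "16 ^ Suc m \<le> 4 * Suc m * (2 * ((2 * m + 1) choose m))\<^sup>2"
    using central_binomial_square_lower[of "Suc m"] by (simp only: le_add1 plus_1_eq_Suc)
  then show ?thesis
    by (simp add: s power_mult power_mult_distrib add_mult_distrib)
qed

text \<open>
  This is what makes a tree with \<open>k + 2 + d\<close> turns, half of them left, large enough for \<open>2\<^sup>k\<close>
  leaves: the middle coefficient of row \<open>s\<close> loses only a factor of order \<open>\<surd>s\<close> against \<open>2\<^sup>s\<close>, and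
  the extra factor \<open>2\<^bsup>d+2\<^esup> > k + 1\<close> more than pays for it.
\<close>
lemma power_le_middle_binomial:
  fixes k d :: nat
  assumes "k + 1 < 2 ^ (d + 2)" "d < k"
  shows "2 ^ k \<le> (k + 2 + d) choose ((k + 2 + d) div 2)"
proof (rule ccontr)
  let ?s = "k + 2 + d"
  let ?c = "?s choose (?s div 2)"
  assume "\<not> ?thesis"
  then have c: "?c\<^sup>2 < (2 ^ k)\<^sup>2" by (intro power_strict_mono) auto
  have "(2 ^ k)\<^sup>2 * (k + 2)\<^sup>2 \<le> (2 ^ k)\<^sup>2 * (2 ^ (d + 2))\<^sup>2"
    using assms(1) by (intro mult_left_mono power_mono) auto
  also have "\<dots> = (2 ^ ?s)\<^sup>2" by (simp add: power_mult_distrib power_add)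
  also have "\<dots> = 4 ^ ?s" by (simp add: power2_eq_square flip: power_mult_distrib)
  also have "\<dots> \<le> 2 * (?s + 1) * ?c\<^sup>2" by (rule middle_binomial_square_lower)
  also have "\<dots> < 2 * (?s + 1) * (2 ^ k)\<^sup>2" using c by (intro mult_strict_left_mono) auto
  finally have "(2 ^ k)\<^sup>2 * (k + 2)\<^sup>2 < (2 ^ k)\<^sup>2 * (2 * (?s + 1))" by (simp only: mult.commute)
  then have "(k + 2)\<^sup>2 < 2 * (?s + 1)" by (simp only: mult_less_cancel1)
  moreover have "2 * (?s + 1) \<le> 4 * k + 4" using assms(2) by simp
  ultimately show False by (simp add: power2_eq_square)
qed

section \<open>Binary trees with few left and few right turns\<close>

datatype 'a ltree = Lf 'a | Nd "'a ltree" "'a ltree"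

primrec leaves :: "'a ltree \<Rightarrow> 'a list" where
  "leaves (Lf x) = [x]"
| "leaves (Nd l r) = leaves l @ leaves r"

primrec nodes :: "'a ltree \<Rightarrow> 'a set set" where
  "nodes (Lf x) = {{x}}"
| "nodes (Nd l r) = insert (set (leaves l) \<union> set (leaves r)) (nodes l \<union> nodes r)"

primrec pieces :: "'a set \<Rightarrow> 'a ltree \<Rightarrow> 'a set set" where
  "pieces S (Lf x) = (if x \<in> S then {{x}} else {})"
| "pieces S (Nd l r) = (if set (leaves l) \<union> set (leaves r) \<subseteq> S
     then {set (leaves l) \<union> set (leaves r)} else pieces S l \<union> pieces S r)"

text \<open>
  The parameters bound the left turns and the right turns on every path from the root to a leaf.
\<close>
fun turns_bounded :: "nat \<Rightarrow> nat \<Rightarrow> 'a ltree \<Rightarrow> bool" where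
  "turns_bounded p q (Lf x) = True"
| "turns_bounded p q (Nd l r) = (0 < p \<and> 0 < q \<and>
     turns_bounded (p - 1) q l \<and> turns_bounded p (q - 1) r)"

lemma leaves_nonempty [simp]: "leaves t \<noteq> []"
  by (induction t) auto

text \<open>
  Pascal's rule splits the capacity of a tree into the capacities left to its two subtrees, each of
  which has used up one turn.
\<close>
lemma turns_bounded_tree_exists:
  assumes "xs \<noteq> []" "length xs \<le> (p + q) choose p"
  shows "\<exists>t. leaves t = xs \<and> turns_bounded p q t"
  using assms
proof (induction "length xs" arbitrary: xs p q rule: less_induct)
  case less
  show ?case
  proof (cases "length xs = 1")
    case True
    then obtain x where "xs = [x]" by (cases xs) auto
    then show ?thesis by (intro exI[of _ "Lf x"]) simp
  next
    case False
    then have len: "2 \<le> length xs" using less.prems(1) by (cases xs) (auto simp: Suc_le_eq)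
    obtain p' where p: "p = Suc p'" using len less.prems(2) by (cases p) auto
    obtain q' where q: "q = Suc q'" using len less.prems(2) by (cases q) auto
    have pascal: "(p + q) choose p = ((p' + q) choose p') + ((p + q') choose p)"
      by (simp add: p q)
    \<comment> \<open>The left subtree is filled up, but one leaf is kept for the right subtree.\<close>
    define m where "m = min ((p' + q) choose p') (length xs - 1)"
    have pos: "1 \<le> (p' + q) choose p'" "1 \<le> (p + q') choose p"
      by (simp_all add: Suc_le_eq)
    have m: "1 \<le> m" "m < length xs" "m \<le> (p' + q) choose p'"
      using len pos by (auto simp: m_def)
    have m': "length xs - m \<le> (p + q') choose p"
      using less.prems(2) pos len unfolding pascal m_def min_def by auto
    obtain l where l: "leaves l = take m xs" "turns_bounded p' q l"
      using less.hyps[of "take m xs" p' q] m less.prems(1) by auto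
    obtain r where r: "leaves r = drop m xs" "turns_bounded p q' r"
      using less.hyps[of "drop m xs" p q'] m m' by fastforce
    show ?thesis using l r by (intro exI[of _ "Nd l r"]) (simp add: p q)
  qed
qed

lemma finite_nodes [simp]: "finite (nodes t)"
  by (induction t) auto

lemma card_nodes: "card (nodes t) < 2 * length (leaves t)"
proof (induction t)
  case (Nd l r)
  have "card (nodes (Nd l r)) \<le> Suc (card (nodes l \<union> nodes r))"
    by (simp add: card_insert_le_m1 card_insert_if)
  also have "\<dots> \<le> Suc (card (nodes l) + card (nodes r))" by (simp add: card_Un_le)
  finally show ?case using Nd by simp
qed simp

lemma nodes_subset_leaves: "X \<in> nodes t \<Longrightarrow> X \<subseteq> set (leaves t)"
  by (induction t) auto

lemma nodes_nonempty: "X \<in> nodes t \<Longrightarrow> X \<noteq> {}"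
  by (induction t) auto

text \<open>
  An inner node needs a turn of each kind to be available, so the last of the \<open>p + q\<close> turns is never
  taken; the maximum accounts for a tree that is a single leaf.
\<close>
lemma card_nodes_through_leaf:
  assumes "turns_bounded p q t" "distinct (leaves t)"
  shows "card {X \<in> nodes t. v \<in> X} \<le> max 1 (p + q)"
  using assms
proof (induction t arbitrary: p q)
  case (Lf x)
  have "card {X \<in> nodes (Lf x). v \<in> X} \<le> card {{x}}" by (intro card_mono) auto
  then show ?case by simp
next
  case (Nd l r)
  let ?N = "\<lambda>t. {X \<in> nodes t. v \<in> X}"
  have disj: "set (leaves l) \<inter> set (leaves r) = {}" using Nd.prems(2) by auto
  have l: "card (?N l) \<le> max 1 (p - 1 + q)" and r: "card (?N r) \<le> max 1 (p + (q - 1))"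
    using Nd.IH(1)[of "p - 1" q] Nd.IH(2)[of p "q - 1"] Nd.prems by auto
  have pq: "0 < p" "0 < q" using Nd.prems(1) by auto
  have N: "?N t = {}" if "v \<notin> set (leaves t)" for t
    using that nodes_subset_leaves[of _ t] by blast
  have "?N l = {} \<or> ?N r = {}"
    using disj N[of l] N[of r] by (cases "v \<in> set (leaves l)") auto
  then have "card (?N l \<union> ?N r) \<le> max (card (?N l)) (card (?N r))"
  proof
    assume "?N l = {}"
    then show ?thesis by (simp only: Un_empty_left max.cobounded2)
  next
    assume "?N r = {}"
    then show ?thesis by (simp only: Un_empty_right max.cobounded1)
  qed
  moreover have "card (?N (Nd l r))
      \<le> card (insert (set (leaves l) \<union> set (leaves r)) (?N l \<union> ?N r))"
    by (intro card_mono) auto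
  moreover have "\<dots> \<le> Suc (card (?N l \<union> ?N r))" by (simp add: card_insert_if)
  ultimately show ?case using l r pq by linarith
qed

lemma pieces_subset_nodes: "pieces S t \<subseteq> nodes t"
  by (induction t) auto

lemma finite_pieces [simp]: "finite (pieces S t)"
  by (rule finite_subset[OF pieces_subset_nodes]) simp

lemma pieces_full: "set (leaves t) \<subseteq> S \<Longrightarrow> pieces S t = {set (leaves t)}"
  by (cases t) auto

lemma Union_pieces: "\<Union> (pieces S t) = S \<inter> set (leaves t)"
  by (induction t) auto

lemma pieces_subset: "X \<in> pieces S t \<Longrightarrow> X \<subseteq> S"
  using Union_pieces[of S t] by blast

lemma pieces_disjoint:
  assumes "distinct (leaves t)" "X \<in> pieces S t" "Y \<in> pieces S t" "X \<inter> Y \<noteq> {}"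
  shows "X = Y"
  using assms
proof (induction t)
  case (Nd l r)
  have "set (leaves l) \<inter> set (leaves r) = {}" using Nd.prems(1) by auto
  then have "A \<inter> B = {}" if "A \<in> pieces S l" "B \<in> pieces S r" for A B
    using Union_pieces[of S l] Union_pieces[of S r] that by blast
  then show ?case using Nd by (auto split: if_splits)
qed (auto split: if_splits)

section \<open>Runs in a list\<close>

text \<open>
  The number of maximal blocks of consecutive list entries in \<open>S\<close>, counted by their last entries.
\<close>
primrec runs :: "'a set \<Rightarrow> 'a list \<Rightarrow> nat" where
  "runs S [] = 0"
| "runs S (x # xs) = runs S xs + of_bool (x \<in> S \<and> (xs = [] \<or> hd xs \<notin> S))"

lemma runs_append:
  assumes "xs \<noteq> []" "ys \<noteq> []"
  shows "runs S (xs @ ys) + of_bool (last xs \<in> S \<and> hd ys \<in> S) = runs S xs + runs S ys"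
  using assms by (induction xs) (auto simp: hd_append)

lemma runs_split: "v \<notin> S \<Longrightarrow> runs S (xs @ v # ys) = runs S xs + runs S ys"
  by (induction xs) (auto simp: hd_append)

lemma runs_cong: "(\<And>x. x \<in> set xs \<Longrightarrow> x \<in> S \<longleftrightarrow> x \<in> T) \<Longrightarrow> runs S xs = runs T xs"
  by (induction xs) auto

lemma runs_empty [simp]: "runs {} xs = 0"
  by (induction xs) auto

lemma runs_pos:
  assumes "x \<in> set xs" "x \<in> S"
  shows "0 < runs S xs"
proof -
  have "S \<inter> set xs = {}" if "runs S xs = 0"
    using that
  proof (induction xs)
    case (Cons y ys)
    then show ?case by (cases ys) (auto split: if_splits)
  qed simp
  then show ?thesis using assms by blast
qed

lemma runs_full: "xs \<noteq> [] \<Longrightarrow> set xs \<subseteq> S \<Longrightarrow> runs S xs = 1"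
proof (induction xs)
  case (Cons y ys)
  then show ?case by (cases ys) auto
qed simp

section \<open>The number of pieces of a union of intervals\<close>

text \<open>
  A run that starts at the left end of the tree costs at most \<open>q\<close> pieces, one for each right turn on
  the path to the first leaf behind it; symmetrically a run at the right end of the tree costs at
  most \<open>p\<close>. For a run inside the tree, the two leaves next to it are separated at some node. There it
  splits into a run at the right end of the left subtree and one at the left end of the right
  subtree, of which one may be empty, and hence costs at most
  \<open>(p - 1) + (q - 1) \<le> \<kappa> + d\<close>. Going down one level lowers both \<open>p + q\<close> and the admissible excess
  \<open>d\<close> by one. Each node separates at most one run, so the total excess \<open>E\<close> over \<open>\<kappa>\<close> per run
  satisfies \<open>E d = d + 2 E (d - 1)\<close>, which is solved by \<open>E d = 2\<^bsup>d+1\<^esup> - d - 2\<close>.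
\<close>
lemma card_pieces:
  assumes "turns_bounded p q t" "\<not> set (leaves t) \<subseteq> S" "p + q \<le> \<kappa> + d + 2"
  shows "int (card (pieces S t)) \<le>
    int q * of_bool (hd (leaves t) \<in> S) + int p * of_bool (last (leaves t) \<in> S)
    + int \<kappa> * (int (runs S (leaves t)) - of_bool (hd (leaves t) \<in> S) - of_bool (last (leaves t) \<in> S))
    + (2 ^ (d + 1) - int d - 2)"
  using assms
proof (induction t arbitrary: p q d)
  case (Lf x)
  have "int (d + 1) < 2 ^ (d + 1)" by (rule of_nat_less_two_power)
  with Lf show ?case by simp
next
  case (Nd l r)
  define E :: "nat \<Rightarrow> int" where "E = (\<lambda>d. 2 ^ (d + 1) - int d - 2)"
  obtain p' where p: "p = Suc p'" using Nd.prems(1) by (cases p) auto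
  obtain q' where q: "q = Suc q'" using Nd.prems(1) by (cases q) auto
  have tb: "turns_bounded p' q l" "turns_bounded p q' r" using Nd.prems(1) by (auto simp: p q)
  have E0: "0 \<le> E e" for e
    using of_nat_less_two_power[of "e + 1", where 'a = int] by (simp add: E_def)
  \<comment> \<open>For \<open>d = 0\<close> the truncated subtraction gives \<open>E 0 = 0\<close> on both sides: there is no excess left.\<close>
  have E1: "int d + 2 * E (d - 1) \<le> E d"
    by (cases d) (auto simp: E_def)
  have sz: "p' + q \<le> \<kappa> + (d - 1) + 2" "p + q' \<le> \<kappa> + (d - 1) + 2"
    using Nd.prems(3) by (auto simp: p q)
  let ?L = "leaves l" and ?R = "leaves r"
  define a b a' b' where "a \<longleftrightarrow> hd ?L \<in> S" and "b \<longleftrightarrow> last ?L \<in> S"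
    and "a' \<longleftrightarrow> hd ?R \<in> S" and "b' \<longleftrightarrow> last ?R \<in> S"
  have ra: "int (runs S (?L @ ?R)) = int (runs S ?L) + int (runs S ?R) - of_bool (b \<and> a')"
    using runs_append[of ?L ?R S] unfolding b_def a'_def
    by (cases "last ?L \<in> S \<and> hd ?R \<in> S") auto
  \<comment> \<open>The products with \<open>\<kappa>\<close> become atoms, which leaves only linear arithmetic below.\<close>
  define K where "K = (\<lambda>xs. int \<kappa> * int (runs S xs))"
  have ru: "K (?L @ ?R) = K ?L + K ?R - int \<kappa> * of_bool (b \<and> a')"
    unfolding K_def ra by (simp only: algebra_simps)
  have cl: "int (card (pieces S l)) \<le> int q * of_bool a + int p' * of_bool b
      + (K ?L - int \<kappa> * of_bool a - int \<kappa> * of_bool b) + E (d - 1)" if "\<not> set ?L \<subseteq> S"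
    using Nd.IH(1)[OF tb(1) that sz(1)] by (simp only: a_def b_def E_def K_def right_diff_distrib)
  have cr: "int (card (pieces S r)) \<le> int q' * of_bool a' + int p * of_bool b'
      + (K ?R - int \<kappa> * of_bool a' - int \<kappa> * of_bool b') + E (d - 1)" if "\<not> set ?R \<subseteq> S"
    using Nd.IH(2)[OF tb(2) that sz(2)] by (simp only: a'_def b'_def E_def K_def right_diff_distrib)
  have cU: "int (card (pieces S (Nd l r))) \<le> int (card (pieces S l)) + int (card (pieces S r))"
    using Nd.prems(2) card_Un_le[of "pieces S l" "pieces S r"] by auto
  have goal: "int (card (pieces S (Nd l r))) \<le> int q * of_bool a + int p * of_bool b'
      + (K (?L @ ?R) - int \<kappa> * of_bool a - int \<kappa> * of_bool b') + E d"
  proof (cases "set ?L \<subseteq> S")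
    case True
    then have lf: "a" "b" "K ?L = int \<kappa>" "card (pieces S l) = 1"
      by (auto simp: a_def b_def K_def runs_full pieces_full)
    have "\<not> set ?R \<subseteq> S" using True Nd.prems(2) by auto
    from cr[OF this] cU lf ru E0[of "d - 1"] E1 show ?thesis
      by (cases a') (simp_all add: q algebra_simps del: pieces.simps)
  next
    case nL: False
    show ?thesis
    proof (cases "set ?R \<subseteq> S")
      case True
      then have rf: "a'" "b'" "K ?R = int \<kappa>" "card (pieces S r) = 1"
        by (auto simp: a'_def b'_def K_def runs_full pieces_full)
      from cl[OF nL] cU rf ru E0[of "d - 1"] E1 show ?thesis
        by (cases b) (simp_all add: p algebra_simps del: pieces.simps)
    next
      case False
      have k: "int p' + int q' \<le> int \<kappa> + int d" using Nd.prems(3) by (simp add: p q)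
      from cl[OF nL] cr[OF False] cU ru E0[of "d - 1"] E1 k show ?thesis
        by (cases b; cases a') (simp_all add: p q algebra_simps del: pieces.simps)
    qed
  qed
  then show ?case by (simp add: a_def b'_def E_def K_def right_diff_distrib del: pieces.simps)
qed

section \<open>Vertex orders and contiguity\<close>

lemma linear_order_on_sorted_list:
  assumes "finite W" "W \<subseteq> V" "linear_order_on V r"
  shows "\<exists>xs. set xs = W \<and> distinct xs \<and> sorted_wrt (\<lambda>x y. (x, y) \<in> r) xs"
  using assms(1,2)
proof (induction W rule: finite_induct)
  case empty
  show ?case by (intro exI[of _ "[]"]) simp
next
  case (insert x W)
  then obtain xs where xs: "set xs = W" "distinct xs" "sorted_wrt (\<lambda>x y. (x, y) \<in> r) xs"
    by auto
  have tot: "(x, y) \<in> r" if "y \<in> W" "(y, x) \<notin> r" for y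
    using assms(3) insert that by (auto simp: linear_order_on_def total_on_def)
  have tr: "trans r" using assms(3)
    by (auto simp: linear_order_on_def partial_order_on_def preorder_on_def)
  \<comment> \<open>Insertion of \<open>x\<close> behind the elements below it.\<close>
  let ?ys = "filter (\<lambda>y. (y, x) \<in> r) xs @ x # filter (\<lambda>y. (y, x) \<notin> r) xs"
  have "sorted_wrt (\<lambda>x y. (x, y) \<in> r) ?ys"
    using xs tot tr by (auto simp: sorted_wrt_append sorted_wrt_filter dest: transD)
  moreover have "set ?ys = insert x W" "distinct ?ys" using xs insert by auto
  ultimately show ?case by blast
qed

lemma runs_eq_card_run_ends:
  "runs S xs = card {i. i < length xs \<and> xs ! i \<in> S \<and> (Suc i < length xs \<longrightarrow> xs ! Suc i \<notin> S)}"
proof (induction xs)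
  case (Cons x xs)
  let ?E = "\<lambda>xs. {i. i < length xs \<and> xs ! i \<in> S \<and> (Suc i < length xs \<longrightarrow> xs ! Suc i \<notin> S)}"
  have fin: "finite (?E xs)" for xs by auto
  have "?E (x # xs) = (if x \<in> S \<and> (xs = [] \<or> hd xs \<notin> S) then {0} else {}) \<union> Suc ` ?E xs"
  proof (rule set_eqI)
    fix i
    show "i \<in> ?E (x # xs)
        \<longleftrightarrow> i \<in> (if x \<in> S \<and> (xs = [] \<or> hd xs \<notin> S) then {0} else {}) \<union> Suc ` ?E xs"
      by (cases i) (auto simp: hd_conv_nth)
  qed
  moreover have "card (Suc ` ?E xs) = card (?E xs)" by (simp add: card_image)
  moreover have "0 \<notin> Suc ` ?E xs" by auto
  ultimately show ?case using Cons fin[of xs] by auto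
qed simp

text \<open>
  The last entry of a run determines a maximal interval, namely the run itself, of which it is the
  greatest element; so distinct runs give distinct intervals.
\<close>
lemma runs_le_card_maximal_intervals:
  assumes r: "linear_order_on V r"
    and xs: "set xs = V" "distinct xs" "sorted_wrt (\<lambda>x y. (x, y) \<in> r) xs"
  shows "runs S xs \<le> card (maximal_intervals V r S)"
proof -
  let ?n = "length xs"
  define E where "E = {i. i < ?n \<and> xs ! i \<in> S \<and> (Suc i < ?n \<longrightarrow> xs ! Suc i \<notin> S)}"
  \<comment> \<open>\<open>I i\<close> is the longest block of entries in \<open>S\<close> that ends at position \<open>i\<close>.\<close>
  define I where "I = (\<lambda>i. {xs ! j | j. j \<le> i \<and> (\<forall>m. j \<le> m \<and> m \<le> i \<longrightarrow> xs ! m \<in> S)})"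
  have refl: "(x, x) \<in> r" if "x \<in> V" for x
    using r that by (auto simp: linear_order_on_def partial_order_on_def preorder_on_def refl_on_def)
  have anti: "antisym r" using r by (auto simp: linear_order_on_def partial_order_on_def)
  have ord: "(xs ! i, xs ! j) \<in> r \<longleftrightarrow> i \<le> j" if "i < ?n" "j < ?n" for i j
  proof
    show "(xs ! i, xs ! j) \<in> r" if "i \<le> j"
      using that xs refl \<open>i < ?n\<close> \<open>j < ?n\<close>
      by (cases "i = j") (auto simp: sorted_wrt_iff_nth_less)
    show "i \<le> j" if "(xs ! i, xs ! j) \<in> r"
    proof (rule ccontr)
      assume "\<not> i \<le> j"
      then have "(xs ! j, xs ! i) \<in> r" using xs(3) \<open>i < ?n\<close> by (auto simp: sorted_wrt_iff_nth_less)
      with that anti have "xs ! i = xs ! j" by (auto dest: antisymD)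
      with \<open>\<not> i \<le> j\<close> show False
        using xs(2) \<open>i < ?n\<close> \<open>j < ?n\<close> by (auto simp: nth_eq_iff_index_eq)
    qed
  qed
  have mem: "xs ! j \<in> I i \<longleftrightarrow> j \<le> i \<and> (\<forall>m. j \<le> m \<and> m \<le> i \<longrightarrow> xs ! m \<in> S)"
    if "i < ?n" "j < ?n" for i j
    using that xs(2) by (auto simp: I_def nth_eq_iff_index_eq)
  have IV: "I i \<subseteq> V" if "i < ?n" for i
    using that xs(1) by (fastforce simp: I_def)
  have max: "I i \<in> maximal_intervals V r S" if i: "i \<in> E" for i
  proof -
    have il: "i < ?n" and iS: "xs ! i \<in> S" using i by (auto simp: E_def)
    have iI: "xs ! i \<in> I i" using mem[OF il il] iS by auto
    have int: "order_interval V r (I i)"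
      unfolding order_interval_def
    proof (intro conjI ballI impI)
      show "I i \<subseteq> V" by (rule IV[OF il])
      fix x y z
      assume x: "x \<in> I i" and y: "y \<in> I i" and z: "z \<in> V" and b: "(x, z) \<in> r \<and> (z, y) \<in> r"
      obtain a where a: "a < ?n" "x = xs ! a" using x IV[OF il] xs(1) by (metis in_set_conv_nth subsetD)
      obtain b where b: "b < ?n" "y = xs ! b" using y IV[OF il] xs(1) by (metis in_set_conv_nth subsetD)
      obtain c where c: "c < ?n" "z = xs ! c" using z xs(1) by (metis in_set_conv_nth)
      have "a \<le> c" "c \<le> b" using \<open>(x, z) \<in> r \<and> (z, y) \<in> r\<close> ord a b c by auto
      then show "z \<in> I i" using x y a b c il by (auto simp: mem)
    qed
    have "J = I i" if J: "order_interval V r J" "J \<subseteq> S" "I i \<subseteq> J" for J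
    proof
      show "J \<subseteq> I i"
      proof
        fix x assume x: "x \<in> J"
        then obtain a where a: "a < ?n" "x = xs ! a"
          using J(1) xs(1) by (metis in_set_conv_nth order_interval_def subsetD)
        have btw: "xs ! m \<in> J" if "c \<le> m" "m \<le> e" "e < ?n" "xs ! c \<in> J" "xs ! e \<in> J" for c m e
        proof -
          have "m < ?n" "c < ?n" using that by auto
          moreover have "(xs ! c, xs ! m) \<in> r" "(xs ! m, xs ! e) \<in> r"
            using that ord by auto
          moreover have "xs ! m \<in> V" using \<open>m < ?n\<close> xs(1) nth_mem by blast
          ultimately show ?thesis using J(1) that(4,5) unfolding order_interval_def by blast
        qed
        have iJ: "xs ! i \<in> J" using iI J(3) by auto
        have "a \<le> i"
        proof (rule ccontr)
          assume "\<not> a \<le> i"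
          then have "Suc i \<le> a" by simp
          then have "xs ! Suc i \<in> J" using btw[of i "Suc i" a] iJ x a by auto
          moreover have "xs ! Suc i \<notin> S" using i \<open>Suc i \<le> a\<close> a by (auto simp: E_def)
          ultimately show False using J(2) by auto
        qed
        then show "x \<in> I i" using btw[of a _ i] x a il iJ J(2) by (auto simp: mem)
      qed
    qed (use J in auto)
    with int iI show ?thesis
      unfolding maximal_intervals_def by (auto simp: I_def)
  qed
  have "inj_on I E"
  proof (rule inj_onI)
    fix i j assume ij: "i \<in> E" "j \<in> E" "I i = I j"
    then have l: "i < ?n" "j < ?n" and S: "xs ! i \<in> S" "xs ! j \<in> S" by (auto simp: E_def)
    have "xs ! i \<in> I i" using mem[OF l(1) l(1)] S by auto
    moreover have "xs ! j \<in> I j" using mem[OF l(2) l(2)] S by auto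
    ultimately have "xs ! i \<in> I j" "xs ! j \<in> I i" using ij(3) by blast+
    then have "i \<le> j" "j \<le> i" using mem l by blast+
    then show "i = j" by simp
  qed
  moreover have "finite (maximal_intervals V r S)"
  proof (rule finite_subset)
    show "maximal_intervals V r S \<subseteq> Pow V"
      by (auto simp: maximal_intervals_def order_interval_def)
    show "finite (Pow V)" using xs(1) by auto
  qed
  ultimately have "card E \<le> card (maximal_intervals V r S)"
    using max by (intro card_inj_on_le[of I]) auto
  then show ?thesis by (simp add: runs_eq_card_run_ends E_def)
qed

lemma order_attaining_contiguity:
  assumes "finite (pverts G)"
  obtains r where "linear_order_on (pverts G) r"
    and "\<And>v. v \<in> pverts G \<Longrightarrow> vertex_contiguity G r v \<le> contiguity G"
proof -
  let ?R = "{r. linear_order_on (pverts G) r}"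
  let ?f = "\<lambda>r. SUP v\<in>pverts G. vertex_contiguity G r v"
  obtain r0 where "well_order_on (pverts G) r0" using well_order_on by blast
  then have "?R \<noteq> {}" by (auto simp: well_order_on_def)
  then have "Inf (?f ` ?R) \<in> ?f ` ?R" by (intro Inf_nat_def1) auto
  then obtain r where r: "linear_order_on (pverts G) r" "contiguity G = ?f r"
    by (auto simp: contiguity_def)
  have "vertex_contiguity G r v \<le> contiguity G" if "v \<in> pverts G" for v
    unfolding r(2) using that assms by (intro cSUP_upper) auto
  with r(1) that show ?thesis by blast
qed

section \<open>The bicliques of a tree\<close>

definition biclique_between :: "'a set \<Rightarrow> 'a set \<Rightarrow> 'a pair_pre_digraph" where
  "biclique_between A X = \<lparr>pverts = A \<union> X, parcs = A \<times> X \<union> X \<times> A\<rparr>"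

lemma biclique_biclique_between:
  assumes G: "pair_graph G" and "A \<noteq> {}" "X \<noteq> {}" and sub: "A \<times> X \<subseteq> parcs G"
  shows "biclique G (biclique_between A X)"
proof -
  interpret pair_graph G by (rule G)
  have sym: "X \<times> A \<subseteq> parcs G" using sub pair_sym_arcs by (auto simp: symmetric_def dest: symD)
  have V: "A \<union> X \<subseteq> pverts G" using sub assms(2,3) by (blast dest: in_arcsD1 in_arcsD2)
  then have fin: "finite A" "finite X" using pair_finite_verts by (auto intro: finite_subset)
  have disj: "A \<inter> X = {}" using sub pair_no_loops by fastforce
  have "pair_wf_digraph (biclique_between A X)"
    by unfold_locales (auto simp: biclique_between_def)
  then have "subgraph (with_proj (biclique_between A X)) (with_proj G)"
    using sub sym V wf_digraph by (auto simp: subgraph_def wf_digraph_wp_iff biclique_between_def compatible_def)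
  moreover have "complete_bipartite_digraph (card A) (card X) (with_proj (biclique_between A X))"
    unfolding complete_bipartite_digraph_pair_def
    using fin disj
    by (intro conjI exI[of _ A] exI[of _ X]) (simp_all add: biclique_between_def)
  moreover have "1 \<le> card A" "1 \<le> card X" using fin assms(2,3) by (auto simp: Suc_le_eq card_gt_0_iff)
  ultimately show ?thesis unfolding biclique_def by blast
qed

definition later :: "'a pair_pre_digraph \<Rightarrow> 'a rel \<Rightarrow> 'a \<Rightarrow> 'a set" where
  "later G r v = {u \<in> nbhd G v. (v, u) \<in> r}"

definition earlier :: "'a pair_pre_digraph \<Rightarrow> 'a rel \<Rightarrow> 'a \<Rightarrow> 'a set" where
  "earlier G r v = {u \<in> nbhd G v. (u, v) \<in> r}"

definition clients :: "'a pair_pre_digraph \<Rightarrow> 'a rel \<Rightarrow> 'a ltree \<Rightarrow> 'a set \<Rightarrow> 'a set" where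
  "clients G r t X = {v \<in> pverts G. X \<in> pieces (later G r v) t}"

definition tree_bicliques ::
    "'a pair_pre_digraph \<Rightarrow> 'a rel \<Rightarrow> 'a ltree \<Rightarrow> 'a pair_pre_digraph set" where
  "tree_bicliques G r t =
     (\<lambda>X. biclique_between (clients G r t X) X) ` {X \<in> nodes t. clients G r t X \<noteq> {}}"

lemma not_in_nbhd_self: "pair_graph G \<Longrightarrow> v \<notin> nbhd G v"
proof -
  assume "pair_graph G"
  then interpret pair_graph G .
  show ?thesis using pair_no_loops by (fastforce simp: nbhd_def)
qed

lemma clients_times_subset: "clients G r t X \<times> X \<subseteq> parcs G"
  by (auto simp: clients_def later_def nbhd_def dest: pieces_subset)

text \<open>
  Let \<open>x\<close> be the earlier endpoint of an edge \<open>xy\<close>. The edge lies in the biclique of the one piece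
  of \<open>x\<close> that contains \<open>y\<close>. No other biclique contains it: \<open>y\<close> is never a client of a node above
  \<open>x\<close>, because the pieces of \<open>y\<close> consist of vertices after \<open>y\<close>, and the pieces of \<open>x\<close> are disjoint.
\<close>
lemma biclique_decomposition_tree_bicliques:
  assumes G: "pair_graph G" and r: "linear_order_on (pverts G) r"
    and t: "set (leaves t) = pverts G" "distinct (leaves t)"
  shows "biclique_decomposition G (tree_bicliques G r t)"
  unfolding biclique_decomposition_def
proof (intro conjI ballI)
  interpret pair_graph G by (rule G)
  let ?B = "\<lambda>X. biclique_between (clients G r t X) X"
  show "biclique G B" if "B \<in> tree_bicliques G r t" for B
    using that biclique_biclique_between[OF G _ _ clients_times_subset] nodes_nonempty
    by (fastforce simp: tree_bicliques_def)
  have sym: "(y, x) \<in> parcs G" if "(x, y) \<in> parcs G" for x y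
    using that pair_sym_arcs by (auto simp: symmetric_def dest: symD)
  have anti: "antisym r" and tot: "total_on (pverts G) r"
    using r by (auto simp: linear_order_on_def partial_order_on_def)
  have ordered: "\<exists>!B. B \<in> tree_bicliques G r t \<and> ((x, y) \<in> parcs B \<or> (y, x) \<in> parcs B)"
    if xy: "(x, y) \<in> parcs G" "(x, y) \<in> r" for x y
  proof -
    have V: "x \<in> pverts G" "y \<in> pverts G" using xy(1) by (auto dest: in_arcsD1 in_arcsD2)
    have ne: "x \<noteq> y" using xy(1) pair_no_loops by fastforce
    have yx: "(y, x) \<notin> r" using xy(2) anti ne by (auto dest: antisymD)
    have "y \<in> \<Union> (pieces (later G r x) t)"
      using xy V t(1) by (simp add: Union_pieces later_def nbhd_def)
    then obtain X where X: "X \<in> pieces (later G r x) t" "y \<in> X" by blast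
    have uniq: "Y = X" if Y: "x \<in> clients G r t Y \<and> y \<in> Y \<or> y \<in> clients G r t Y \<and> x \<in> Y" for Y
    proof -
      have "x \<notin> Y" if "y \<in> clients G r t Y"
        using that yx pieces_subset[of Y "later G r y" t] by (auto simp: clients_def later_def)
      then have "Y \<in> pieces (later G r x) t" "y \<in> Y" using Y by (auto simp: clients_def)
      then show ?thesis using pieces_disjoint[OF t(2)] X by blast
    qed
    have arc: "(x, y) \<in> parcs (?B Y) \<or> (y, x) \<in> parcs (?B Y)
        \<longleftrightarrow> x \<in> clients G r t Y \<and> y \<in> Y \<or> y \<in> clients G r t Y \<and> x \<in> Y" for Y
      by (auto simp: biclique_between_def)
    show ?thesis
    proof (rule ex1I[of _ "?B X"])
      have "x \<in> clients G r t X" using X V by (simp add: clients_def)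
      moreover have "X \<in> nodes t" using X pieces_subset_nodes by blast
      ultimately show "?B X \<in> tree_bicliques G r t
          \<and> ((x, y) \<in> parcs (?B X) \<or> (y, x) \<in> parcs (?B X))"
        using X(2) unfolding arc by (auto simp: tree_bicliques_def)
    next
      fix B
      assume B: "B \<in> tree_bicliques G r t \<and> ((x, y) \<in> parcs B \<or> (y, x) \<in> parcs B)"
      then obtain Y where Y: "B = ?B Y" by (auto simp: tree_bicliques_def)
      have "Y = X" by (rule uniq) (use B arc[of Y] in \<open>simp only: Y simp_thms\<close>)
      then show "B = ?B X" by (simp only: Y)
    qed
  qed
  have B_sym: "(x, y) \<in> parcs B \<longleftrightarrow> (y, x) \<in> parcs B" if "B \<in> tree_bicliques G r t" for x y B
    using that by (auto simp: tree_bicliques_def biclique_between_def)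
  fix e assume e: "e \<in> parcs G"
  obtain x y where xy: "e = (x, y)" by (cases e)
  have "x \<in> pverts G" "y \<in> pverts G" "x \<noteq> y"
    using e xy pair_no_loops[of e] by (auto dest: in_arcsD1 in_arcsD2)
  then have "(x, y) \<in> r \<or> (y, x) \<in> r" using tot by (auto simp: total_on_def)
  then have "\<exists>!B. B \<in> tree_bicliques G r t \<and> ((x, y) \<in> parcs B \<or> (y, x) \<in> parcs B)"
    using ordered[of x y] ordered[of y x] e sym[of x y] unfolding xy by (metis (no_types))
  then show "\<exists>!B. B \<in> tree_bicliques G r t \<and> e \<in> parcs B"
    unfolding xy using B_sym by (metis (no_types, lifting))
qed

text \<open>
  A vertex \<open>v\<close> is in a biclique either as a client, of one of its own pieces, or because the node
  lies above it. In the second case every client is an earlier neighbour of \<open>v\<close>; and the node is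
  not the root, because the root contains its would-be clients, which are not their own neighbours.
\<close>
lemma card_tree_bicliques_at_vertex:
  assumes G: "pair_graph G" and t: "set (leaves t) = pverts G" "distinct (leaves t)"
    and tb: "turns_bounded p q t" and v: "v \<in> pverts G"
  shows "card {B \<in> tree_bicliques G r t. v \<in> pverts B}
    \<le> card (pieces (later G r v) t) + (if earlier G r v = {} then 0 else p + q - 1)"
proof -
  interpret pair_graph G by (rule G)
  let ?B = "\<lambda>X. biclique_between (clients G r t X) X"
  define N where "N = {X \<in> nodes t. v \<in> X}"
  define U where "U = {X \<in> nodes t. v \<in> X \<and> clients G r t X \<noteq> {}}"
  have root: "pverts G \<notin> U" unfolding U_def
    using not_in_nbhd_self[OF G] by (auto simp: clients_def later_def dest!: pieces_subset)
  have rootN: "pverts G \<in> N" using t v by (cases t) (auto simp: N_def)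
  have fin: "finite N" by (simp add: N_def)
  have "U \<subseteq> N - {pverts G}" using root by (auto simp: U_def N_def)
  then have "card U \<le> card N - 1"
    using fin rootN card_mono[of "N - {pverts G}" U] by (simp add: card_Diff_singleton)
  also have "\<dots> \<le> p + q - 1"
    using card_nodes_through_leaf[OF tb t(2), of v] unfolding N_def by linarith
  finally have cU: "card U \<le> p + q - 1" .
  have eU: "U = {}" if "earlier G r v = {}"
  proof (rule ccontr)
    assume "U \<noteq> {}"
    then obtain X u where X: "v \<in> X" "X \<in> pieces (later G r u) t"
      by (auto simp: U_def clients_def)
    then have "v \<in> later G r u" using pieces_subset by blast
    then have "u \<in> earlier G r v"
      using pair_sym_arcs by (auto simp: later_def earlier_def nbhd_def symmetric_def dest: symD)
    with that show False by simp
  qed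
  have "{B \<in> tree_bicliques G r t. v \<in> pverts B} \<subseteq> ?B ` (pieces (later G r v) t \<union> U)"
  proof (rule subsetI)
    fix B assume B: "B \<in> {B \<in> tree_bicliques G r t. v \<in> pverts B}"
    then obtain X where X: "X \<in> nodes t" "clients G r t X \<noteq> {}" "B = ?B X"
      unfolding tree_bicliques_def by blast
    then have "v \<in> clients G r t X \<or> v \<in> X" using B by (simp add: biclique_between_def)
    then have "X \<in> pieces (later G r v) t \<union> U" using X(1,2) by (auto simp: U_def clients_def)
    with X(3) show "B \<in> ?B ` (pieces (later G r v) t \<union> U)" by blast
  qed
  then have "card {B \<in> tree_bicliques G r t. v \<in> pverts B} \<le> card (?B ` (pieces (later G r v) t \<union> U))"
    by (intro card_mono) (auto simp: U_def)
  also have "\<dots> \<le> card (pieces (later G r v) t \<union> U)"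
    by (intro card_image_le) (auto simp: U_def)
  also have "\<dots> \<le> card (pieces (later G r v) t) + card U" by (rule card_Un_le)
  finally show ?thesis using cU eU by (auto split: if_splits)
qed

text \<open>
  Since \<open>v\<close> is not its own neighbour, no run of its neighbourhood extends across \<open>v\<close>.
\<close>
lemma runs_nbhd_split:
  assumes G: "pair_graph G" and r: "antisym r"
    and xs: "distinct xs" "sorted_wrt (\<lambda>x y. (x, y) \<in> r) xs" "v \<in> set xs"
  shows "runs (nbhd G v) xs = runs (earlier G r v) xs + runs (later G r v) xs"
proof -
  obtain as bs where s: "xs = as @ v # bs" using split_list[OF xs(3)] by blast
  have a: "(u, v) \<in> r" "(v, u) \<notin> r" if "u \<in> set as" for u
    using that xs(1,2) r by (auto simp: s sorted_wrt_append dest: antisymD)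
  have b: "(v, u) \<in> r" "(u, v) \<notin> r" if "u \<in> set bs" for u
    using that xs(1,2) r by (auto simp: s sorted_wrt_append dest: antisymD)
  have nv: "v \<notin> nbhd G v" by (rule not_in_nbhd_self[OF G])
  have "runs (earlier G r v) as = runs (nbhd G v) as" "runs (later G r v) as = runs {} as"
    "runs (earlier G r v) bs = runs {} bs" "runs (later G r v) bs = runs (nbhd G v) bs"
    using a b by (auto intro!: runs_cong simp: earlier_def later_def simp del: runs_empty)
  moreover have "v \<notin> earlier G r v" "v \<notin> later G r v" using nv by (auto simp: earlier_def later_def)
  ultimately show ?thesis using nv by (simp add: s runs_split)
qed

section \<open>Choice of the tree\<close>

theorem lemma3:
  fixes G :: "'a pair_pre_digraph" and n l :: nat
  assumes "pair_graph G"
    and "card (pverts G) = n"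
    and "contiguity G = l"
  shows "\<exists>D. biclique_decomposition G D \<and> finite D \<and> card D \<le> 2 * n \<and>
           (\<forall>v\<in>pverts G.
              int (card {B \<in> D. v \<in> pverts B}) \<le> (int l + 1) * \<lceil>log 2 (real n)\<rceil>)"
proof (cases "2 \<le> n")
  case False
  interpret pair_graph G by (rule assms(1))
  have "card (pverts G) \<le> Suc 0" using False assms(2) by simp
  then have eq: "\<forall>x\<in>pverts G. \<forall>y\<in>pverts G. x = y"
    by (simp only: card_le_Suc0_iff_eq[OF pair_finite_verts])
  have "e \<notin> parcs G" for e
  proof
    assume e: "e \<in> parcs G"
    have "fst e = snd e" using eq arc_fst_in_verts[OF e] arc_snd_in_verts[OF e] by blast
    with pair_no_loops[OF e] show False by contradiction
  qed
  then have "parcs G = {}" by blast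
  moreover have "log 2 (real n) = 0" using False by (cases n) (auto simp: log_def)
  ultimately show ?thesis by (intro exI[of _ "{}"]) (auto simp: biclique_decomposition_def)
next
  case True
  interpret pair_graph G by (rule assms(1))
  obtain r where r: "linear_order_on (pverts G) r"
    and cont: "\<And>v. v \<in> pverts G \<Longrightarrow> vertex_contiguity G r v \<le> l"
    using order_attaining_contiguity[OF pair_finite_verts] assms(3) by blast
  obtain xs where xs: "set xs = pverts G" "distinct xs" "sorted_wrt (\<lambda>x y. (x, y) \<in> r) xs"
    using linear_order_on_sorted_list[OF pair_finite_verts subset_refl r] by blast
  have len: "length xs = n" using xs assms(2) distinct_card by fastforce
  have anti: "antisym r" using r by (auto simp: linear_order_on_def partial_order_on_def)

  define k where "k = nat \<lceil>log 2 (real n)\<rceil>"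
  have log1: "1 \<le> log 2 (real n)" using True by (simp add: le_log_iff)
  then have k: "int k = \<lceil>log 2 (real n)\<rceil>" "1 \<le> k" unfolding k_def by linarith+
  have "real n = 2 powr log 2 (real n)" using True by simp
  also have "\<dots> \<le> 2 powr real k" unfolding k_def by (intro powr_mono) (auto simp: real_nat_ceiling_ge)
  also have "\<dots> = real (2 ^ k)" by (simp add: powr_realpow)
  finally have nk: "n \<le> 2 ^ k" by (simp only: of_nat_le_iff)

  \<comment> \<open>The largest \<open>d\<close> for which the excess \<open>2\<^bsup>d+1\<^esup> - d - 2\<close> is at most \<open>k - 1 - d\<close>.\<close>
  obtain e where e: "2 ^ e \<le> k + 1" "k + 1 < 2 ^ (e + 1)"
    using ex_power_ivl1[of 2 "k + 1"] by auto
  have "e \<noteq> 0" using e k(2) by (cases e) auto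
  then obtain d where d: "2 ^ (d + 1) \<le> k + 1" "k + 1 < 2 ^ (d + 2)"
    using e by (cases e) auto
  have dk: "d + 2 \<le> k + 1" using d(1) less_exp[of "d + 1"] by linarith
  define p q where "p = (k + 2 + d) div 2" and "q = k + 2 + d - p"
  have pq: "p + q = k + 2 + d" and pk: "p \<le> k" using dk by (auto simp: p_def q_def)
  have "2 ^ k \<le> (k + 2 + d) choose p"
    unfolding p_def using d(2) dk by (intro power_le_middle_binomial) auto
  with nk have "n \<le> (p + q) choose p" unfolding pq by linarith
  moreover have "xs \<noteq> []" using len True by auto
  ultimately obtain t where t: "leaves t = xs" "turns_bounded p q t"
    using turns_bounded_tree_exists[of xs p q] len by blast
  define D where "D = tree_bicliques G r t"
  have "biclique_decomposition G D"
    unfolding D_def using xs by (intro biclique_decomposition_tree_bicliques assms(1) r) (auto simp: t)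
  moreover have "finite D" by (simp add: D_def tree_bicliques_def)
  moreover have "card D \<le> 2 * n"
  proof -
    have "card D \<le> card {X \<in> nodes t. clients G r t X \<noteq> {}}"
      unfolding D_def tree_bicliques_def by (intro card_image_le) simp
    also have "\<dots> \<le> card (nodes t)" by (intro card_mono) auto
    also have "\<dots> \<le> 2 * n" using card_nodes[of t] t len by simp
    finally show ?thesis .
  qed
  moreover have "int (card {B \<in> D. v \<in> pverts B}) \<le> (int l + 1) * \<lceil>log 2 (real n)\<rceil>"
    if v: "v \<in> pverts G" for v
  proof -
    let ?S = "later G r v"
    define a b where "a = runs ?S xs" and "b = runs (earlier G r v) xs"
    have nv: "v \<notin> ?S" using not_in_nbhd_self[OF assms(1)] by (auto simp: later_def)
    \<comment> \<open>No run of later neighbours touches the left end of the tree, so none is charged \<open>q\<close>.\<close>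
    have first: "hd xs \<notin> ?S"
    proof
      assume h: "hd xs \<in> ?S"
      then have "hd xs \<noteq> v" using nv by blast
      moreover have "xs = hd xs # tl xs" using len True by (cases xs) auto
      ultimately have "(hd xs, v) \<in> r" using xs v by (metis set_ConsD sorted_wrt.simps(2))
      with h anti \<open>hd xs \<noteq> v\<close> show False by (auto simp: later_def dest: antisymD)
    qed
    have "\<not> set (leaves t) \<subseteq> ?S" using v nv xs(1) t(1) by blast
    then have "int (card (pieces ?S t)) \<le> int p * of_bool (last xs \<in> ?S)
        + int k * (int a - of_bool (last xs \<in> ?S)) + (2 ^ (d + 1) - int d - 2)"
      using card_pieces[OF t(2), of ?S k d] first pq by (simp add: t a_def)
    also have "\<dots> \<le> int a * int k + (2 ^ (d + 1) - int d - 2)"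
      using pk by (simp add: algebra_simps)
    also have "\<dots> \<le> int a * int k + int k - 1 - int d"
    proof -
      have "int (2 ^ (d + 1)) \<le> int (k + 1)" using d(1) by (simp only: of_nat_le_iff)
      then show ?thesis by simp
    qed
    finally have pieces: "int (card (pieces ?S t)) \<le> int a * int k + int k - 1 - int d" .
    have "runs (nbhd G v) xs \<le> card (maximal_intervals (pverts G) r (nbhd G v))"
      by (rule runs_le_card_maximal_intervals[OF r xs])
    also have "\<dots> \<le> l" using cont[OF v] by (simp add: vertex_contiguity_def)
    finally have ab: "a + b \<le> l"
      using runs_nbhd_split[OF assms(1) anti xs(2,3)] v xs(1) by (simp add: a_def b_def)
    have count: "card {B \<in> D. v \<in> pverts B}
        \<le> card (pieces ?S t) + (if earlier G r v = {} then 0 else p + q - 1)"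
      unfolding D_def using xs by (intro card_tree_bicliques_at_vertex assms(1) t(2) v) (auto simp: t)
    have "int (card {B \<in> D. v \<in> pverts B}) \<le> (int a + int b + 1) * int k"
    proof (cases "earlier G r v = {}")
      case True
      then show ?thesis using count pieces by (simp add: b_def algebra_simps)
    next
      case False
      then obtain u where "u \<in> earlier G r v" by blast
      moreover from this have "u \<in> set xs" using xs(1) by (auto simp: earlier_def nbhd_def dest: in_arcsD2)
      ultimately have "1 \<le> b" unfolding b_def using runs_pos by (simp add: Suc_le_eq)
      then have "1 * int k \<le> int b * int k" by (intro mult_right_mono) auto
      moreover have "int (card {B \<in> D. v \<in> pverts B}) \<le> int a * int k + 2 * int k"
        using count pieces False pq by simp
      ultimately show ?thesis by (simp add: algebra_simps)
    qed
    also have "\<dots> \<le> (int l + 1) * int k" using ab by (intro mult_right_mono) auto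
    finally show ?thesis by (simp only: k(1))
  qed
  ultimately show ?thesis by blast
qed

end
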